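(* Let $G$ be an overlap graph. Suppose that for each $j$ with $2\le j\le\omega(G)$ there is a number $\alpha_j$ such that every clean induced subgraph $H$ of $G$ with $\omega(H)\le j$ satisfies $\chi(H)\le\alpha_j$. Then $\chi(G)\le\prod_{j=2}^{\omega(G)}2\alpha_j$.
   Context: Two sets overlap if they intersect and neither contains the other. A graph $G$ is an overlap graph if there is a bijection $\mu$ from $V(G)$ to a finite family of sets with $uv\in E(G)$ iff $\mu(u),\mu(v)$ overlap (an overlap model). An overlap model is clean if there are no three members such that two overlapping ones both contain the third; an overlap graph is clean if it has a clean overlap model. $\chi$ and $\omega$ are chromatic and clique number. *)

theory Defs
  imports Complex_Main "HOL-Library.Ramsey"
begin

text \<open>A finite simple graph is a pair of a finite vertex set \<open>V\<close> and a set \<open>E\<close> of two-element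
  subsets of \<open>V\<close>.\<close>

definition simple_graph :: "'a set \<Rightarrow> 'a set set \<Rightarrow> bool" where
  "simple_graph V E \<longleftrightarrow> finite V \<and> E \<subseteq> [V]\<^bsup>2\<^esup>"

definition induced_edges :: "'a set set \<Rightarrow> 'a set \<Rightarrow> 'a set set" where
  "induced_edges E W = {e \<in> E. e \<subseteq> W}"

definition clique_number :: "'a set \<Rightarrow> 'a set set \<Rightarrow> nat" where
  "clique_number V E = Max (card ` {K. K \<subseteq> V \<and> clique K E})"

definition proper_colouring :: "'a set \<Rightarrow> 'a set set \<Rightarrow> nat \<Rightarrow> ('a \<Rightarrow> nat) \<Rightarrow> bool" where
  "proper_colouring V E k c \<longleftrightarrow>
     c ` V \<subseteq> {..<k} \<and> (\<forall>u\<in>V. \<forall>v\<in>V. {u, v} \<in> E \<longrightarrow> c u \<noteq> c v)"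

definition chromatic_number :: "'a set \<Rightarrow> 'a set set \<Rightarrow> nat" where
  "chromatic_number V E = (LEAST k. \<exists>c. proper_colouring V E k c)"

definition overlap :: "'b set \<Rightarrow> 'b set \<Rightarrow> bool" where
  "overlap A B \<longleftrightarrow> A \<inter> B \<noteq> {} \<and> \<not> A \<subseteq> B \<and> \<not> B \<subseteq> A"

text \<open>The family of sets is the image \<open>\<mu> ` V\<close>, so the bijection requirement is injectivity on
  \<open>V\<close>; the family is finite because \<open>V\<close> is.\<close>

definition overlap_model :: "'a set \<Rightarrow> 'a set set \<Rightarrow> ('a \<Rightarrow> 'b set) \<Rightarrow> bool" where
  "overlap_model V E \<mu> \<longleftrightarrow>
     inj_on \<mu> V \<and> (\<forall>u\<in>V. \<forall>v\<in>V. {u, v} \<in> E \<longleftrightarrow> overlap (\<mu> u) (\<mu> v))"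

text \<open>The three members are automatically distinct: overlapping sets differ, and neither contains
  the other.\<close>

definition clean_model :: "'a set \<Rightarrow> ('a \<Rightarrow> 'b set) \<Rightarrow> bool" where
  "clean_model V \<mu> \<longleftrightarrow>
     \<not> (\<exists>u\<in>V. \<exists>v\<in>V. \<exists>w\<in>V. overlap (\<mu> u) (\<mu> v) \<and> \<mu> w \<subseteq> \<mu> u \<and> \<mu> w \<subseteq> \<mu> v)"

text \<open>HOL cannot quantify over the ground type of the model, so models by sets of naturals are
  used. This loses nothing: by the two introduction lemmas below, a finite graph with a (clean)
  model over any type has one over the naturals.\<close>

definition overlap_graph :: "'a set \<Rightarrow> 'a set set \<Rightarrow> bool" where
  "overlap_graph V E \<longleftrightarrow> simple_graph V E \<and> (\<exists>\<mu> :: 'a \<Rightarrow> nat set. overlap_model V E \<mu>)"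

definition clean_overlap_graph :: "'a set \<Rightarrow> 'a set set \<Rightarrow> bool" where
  "clean_overlap_graph V E \<longleftrightarrow>
     simple_graph V E \<and> (\<exists>\<mu> :: 'a \<Rightarrow> nat set. overlap_model V E \<mu> \<and> clean_model V \<mu>)"

lemma nat_model_exists:
  fixes \<mu> :: "'a \<Rightarrow> 'b set"
  assumes "finite V"
  shows "\<exists>\<nu> :: 'a \<Rightarrow> nat set.
    (\<forall>u\<in>V. \<forall>v\<in>V. \<nu> u \<subseteq> \<nu> v \<longleftrightarrow> \<mu> u \<subseteq> \<mu> v) \<and>
    (\<forall>u\<in>V. \<forall>v\<in>V. \<nu> u \<inter> \<nu> v = {} \<longleftrightarrow> \<mu> u \<inter> \<mu> v = {})"
proof -
  define cell where "cell x = {v \<in> V. x \<in> \<mu> v}" for x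
  have "finite (range cell)"
    by (rule finite_subset[of _ "Pow V"]) (use assms in \<open>auto simp: cell_def\<close>)
  then obtain f :: "'a set \<Rightarrow> nat" where f: "inj_on f (range cell)"
    using finite_imp_inj_to_nat_seg[of "range cell"] by auto
  define \<nu> where "\<nu> v = (\<lambda>x. f (cell x)) ` \<mu> v" for v
  have mem: "f (cell x) \<in> \<nu> v \<longleftrightarrow> x \<in> \<mu> v" if "v \<in> V" for x v
  proof
    assume "f (cell x) \<in> \<nu> v"
    then obtain y where y: "y \<in> \<mu> v" "f (cell x) = f (cell y)"
      by (auto simp: \<nu>_def)
    then have "cell x = cell y"
      using f by (simp add: inj_on_eq_iff)
    moreover have "v \<in> cell y"
      using y that by (simp add: cell_def)
    ultimately have "v \<in> cell x"
      by simp
    then show "x \<in> \<mu> v"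
      by (simp add: cell_def)
  qed (auto simp: \<nu>_def)
  show ?thesis
  proof (intro exI[of _ \<nu>] conjI ballI)
    fix u v assume uv: "u \<in> V" "v \<in> V"
    show "\<nu> u \<subseteq> \<nu> v \<longleftrightarrow> \<mu> u \<subseteq> \<mu> v"
    proof
      assume "\<nu> u \<subseteq> \<nu> v"
      then show "\<mu> u \<subseteq> \<mu> v"
        using mem[OF uv(1)] mem[OF uv(2)] by blast
    qed (auto simp: \<nu>_def)
  next
    fix u v assume uv: "u \<in> V" "v \<in> V"
    show "\<nu> u \<inter> \<nu> v = {} \<longleftrightarrow> \<mu> u \<inter> \<mu> v = {}"
    proof
      assume "\<nu> u \<inter> \<nu> v = {}"
      then show "\<mu> u \<inter> \<mu> v = {}"
        using mem[OF uv(1)] mem[OF uv(2)] by blast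
    next
      assume *: "\<mu> u \<inter> \<mu> v = {}"
      have "n \<notin> \<nu> v" if n: "n \<in> \<nu> u" for n
      proof -
        obtain x where x: "x \<in> \<mu> u" "n = f (cell x)"
          using n by (auto simp: \<nu>_def)
        with * have "x \<notin> \<mu> v"
          by blast
        then show ?thesis
          by (simp add: x(2) mem[OF uv(2)])
      qed
      then show "\<nu> u \<inter> \<nu> v = {}"
        by blast
    qed
  qed
qed

lemma overlap_transfer:
  assumes "\<forall>u\<in>V. \<forall>v\<in>V. \<nu> u \<subseteq> \<nu> v \<longleftrightarrow> \<mu> u \<subseteq> \<mu> v"
    and "\<forall>u\<in>V. \<forall>v\<in>V. \<nu> u \<inter> \<nu> v = {} \<longleftrightarrow> \<mu> u \<inter> \<mu> v = {}"
  shows "overlap_model V E \<nu> \<longleftrightarrow> overlap_model V E \<mu>" "clean_model V \<nu> \<longleftrightarrow> clean_model V \<mu>"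
proof -
  have ov: "overlap (\<nu> u) (\<nu> v) \<longleftrightarrow> overlap (\<mu> u) (\<mu> v)" if "u \<in> V" "v \<in> V" for u v
    using assms that by (simp add: overlap_def)
  have "\<nu> u = \<nu> v \<longleftrightarrow> \<mu> u = \<mu> v" if "u \<in> V" "v \<in> V" for u v
    using assms(1) that by (simp add: set_eq_subset)
  then have "inj_on \<nu> V \<longleftrightarrow> inj_on \<mu> V"
    by (simp add: inj_on_def)
  then show "overlap_model V E \<nu> \<longleftrightarrow> overlap_model V E \<mu>"
    using ov by (simp add: overlap_model_def)
  show "clean_model V \<nu> \<longleftrightarrow> clean_model V \<mu>"
    using ov assms(1) by (simp add: clean_model_def)
qed

lemma overlap_graphI:
  fixes \<mu> :: "'a \<Rightarrow> 'b set"
  assumes "simple_graph V E" and "overlap_model V E \<mu>"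
  shows "overlap_graph V E"
proof -
  have "finite V"
    using assms(1) by (simp add: simple_graph_def)
  then obtain \<nu> :: "'a \<Rightarrow> nat set" where \<nu>:
    "\<forall>u\<in>V. \<forall>v\<in>V. \<nu> u \<subseteq> \<nu> v \<longleftrightarrow> \<mu> u \<subseteq> \<mu> v"
    "\<forall>u\<in>V. \<forall>v\<in>V. \<nu> u \<inter> \<nu> v = {} \<longleftrightarrow> \<mu> u \<inter> \<mu> v = {}"
    using nat_model_exists[of V \<mu>] by auto
  have "overlap_model V E \<nu>"
    using overlap_transfer(1)[of V \<nu> \<mu>, OF \<nu>] assms(2) by blast
  then show ?thesis
    using assms(1) unfolding overlap_graph_def by blast
qed

lemma clean_overlap_graphI:
  fixes \<mu> :: "'a \<Rightarrow> 'b set"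
  assumes "simple_graph V E" and "overlap_model V E \<mu>" and "clean_model V \<mu>"
  shows "clean_overlap_graph V E"
proof -
  have "finite V"
    using assms(1) by (simp add: simple_graph_def)
  then obtain \<nu> :: "'a \<Rightarrow> nat set" where \<nu>:
    "\<forall>u\<in>V. \<forall>v\<in>V. \<nu> u \<subseteq> \<nu> v \<longleftrightarrow> \<mu> u \<subseteq> \<mu> v"
    "\<forall>u\<in>V. \<forall>v\<in>V. \<nu> u \<inter> \<nu> v = {} \<longleftrightarrow> \<mu> u \<inter> \<mu> v = {}"
    using nat_model_exists[of V \<mu>] by auto
  have "overlap_model V E \<nu>" "clean_model V \<nu>"
    using overlap_transfer[of V \<nu> \<mu>, OF \<nu>] assms(2,3) by blast+
  then show ?thesis
    using assms(1) unfolding clean_overlap_graph_def by blast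
qed

end

theory Submission
  imports Defs
begin

text \<open>
  Peel off, again and again, the vertices that are not contained in two overlapping members of
  what is left; the round in which a vertex is removed is its rank. Each rank class is clean. If
  \<open>x\<close> has smaller rank than \<open>y\<close>, then \<open>\<mu> x\<close> is not contained in \<open>\<mu> y\<close>, since otherwise
  the overlapping pair that contains \<open>\<mu> y\<close> would also contain \<open>\<mu> x\<close>. Let \<open>w\<close> be the vertex of
  highest rank \<open>i\<close> in a clique whose other vertices have rank at most \<open>i - 2\<close>, and let \<open>u, v\<close> be an
  overlapping pair of rank at least \<open>i - 1\<close> containing \<open>w\<close>: replacing \<open>w\<close> by \<open>u\<close> and \<open>v\<close> gives a larger
  clique. Hence colouring each rank class properly and adding the parity of the rank to the colour
  leaves no monochromatic clique of maximum size, so every colour class has smaller clique number,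
  and one proceeds by induction.
\<close>

section \<open>Colourings and cliques of finite graphs\<close>

lemma proper_colouring_mono:
  assumes "proper_colouring V E k c" "k \<le> l"
  shows "proper_colouring V E l c"
  using assms by (fastforce simp: proper_colouring_def)

lemma proper_colouring_induced:
  "proper_colouring W (induced_edges E W) k c \<longleftrightarrow> proper_colouring W E k c"
  by (auto simp: proper_colouring_def induced_edges_def)

lemma simple_graph_no_loop:
  assumes "simple_graph V E"
  shows "{u} \<notin> E"
  using assms by (auto simp: simple_graph_def nsets_def)

lemma simple_graph_induced:
  assumes "simple_graph V E" "W \<subseteq> V"
  shows "simple_graph W (induced_edges E W)"
  using assms by (auto simp: simple_graph_def induced_edges_def nsets_def intro: finite_subset)

text \<open>An injective numbering of \<open>V\<close> is a proper colouring, because there are no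
  loops. So the \<open>LEAST\<close> in the definition is attained, and spare colours do no
  harm.\<close>

lemma chromatic_number_le_iff:
  assumes "simple_graph V E"
  shows "chromatic_number V E \<le> k \<longleftrightarrow> (\<exists>c. proper_colouring V E k c)"
proof
  have "finite V"
    using assms by (simp add: simple_graph_def)
  then obtain h n where h: "h ` V = {i::nat. i < n}" "inj_on h V"
    using finite_imp_inj_to_nat_seg by metis
  have "h u \<noteq> h v" if "u \<in> V" "v \<in> V" "{u, v} \<in> E" for u v
  proof -
    have "u \<noteq> v"
      using simple_graph_no_loop[OF assms] that(3) by auto
    then show ?thesis
      using h(2) that by (auto dest: inj_onD)
  qed
  then have "proper_colouring V E n h"
    using h(1) by (auto simp: proper_colouring_def)
  then have "\<exists>k c. proper_colouring V E k c"
    by blast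
  then have "\<exists>c. proper_colouring V E (chromatic_number V E) c"
    unfolding chromatic_number_def by (rule LeastI_ex)
  then show "\<exists>c. proper_colouring V E k c" if "chromatic_number V E \<le> k"
    using that proper_colouring_mono by blast
next
  assume "\<exists>c. proper_colouring V E k c"
  then show "chromatic_number V E \<le> k"
    unfolding chromatic_number_def by (rule Least_le)
qed

lemma clique_number_le_iff:
  assumes "finite V"
  shows "clique_number V E \<le> m \<longleftrightarrow> (\<forall>K\<subseteq>V. clique K E \<longrightarrow> card K \<le> m)"
proof -
  have "finite (card ` {K. K \<subseteq> V \<and> clique K E})"
    using assms by simp
  moreover have "card ` {K. K \<subseteq> V \<and> clique K E} \<noteq> {}"
    by (auto simp: clique_def)
  ultimately show ?thesis
    unfolding clique_number_def by (subst Max_le_iff) auto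
qed

lemma clique_induced:
  assumes "K \<subseteq> W"
  shows "clique K (induced_edges E W) \<longleftrightarrow> clique K E"
  using assms by (auto simp: clique_def induced_edges_def)

text \<open>A vertex \<open>w\<close> gets the pair of its fibre index and its colour inside the
  fibre, written as one number in base \<open>b\<close>; division with remainder by \<open>b\<close>
  recovers both.\<close>

lemma proper_colouring_fibres:
  assumes "finite I" "f ` W \<subseteq> I"
    and "\<And>i. i \<in> I \<Longrightarrow> \<exists>c. proper_colouring {w \<in> W. f w = i} E b c"
  shows "\<exists>c. proper_colouring W E (card I * b) c"
proof -
  obtain h where h: "bij_betw h I {0..<card I}"
    using ex_bij_betw_finite_nat[OF assms(1)] by blast
  obtain g where g: "\<And>i. i \<in> I \<Longrightarrow> proper_colouring {w \<in> W. f w = i} E b (g i)"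
    using assms(3) by metis
  define c where "c w = h (f w) * b + g (f w) w" for w
  have hI: "h (f w) < card I" "f w \<in> I" if "w \<in> W" for w
    using that assms(2) bij_betwE[OF h] by fastforce+
  have gb: "g (f w) w < b" if "w \<in> W" for w
    using g[OF hI(2)[OF that]] that by (auto simp: proper_colouring_def)
  have "c w < card I * b" if "w \<in> W" for w
  proof -
    have "c w < Suc (h (f w)) * b"
      using gb[OF that] by (simp add: c_def)
    also have "\<dots> \<le> card I * b"
      using hI(1)[OF that] by (intro mult_le_mono1) simp
    finally show ?thesis .
  qed
  moreover have "c u \<noteq> c v" if uv: "u \<in> W" "v \<in> W" "{u, v} \<in> E" for u v
  proof
    assume eq: "c u = c v"
    have "h (f w) = c w div b" "g (f w) w = c w mod b" if "w \<in> W" for w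
      using gb[OF that] by (simp_all add: c_def)
    then have *: "h (f u) = h (f v)" "g (f u) u = g (f v) v"
      using uv eq by metis+
    have "f u = f v"
      using h * hI(2) uv by (auto simp: bij_betw_def dest: inj_onD)
    then show False
      using g[OF hI(2)[OF uv(1)]] * uv by (auto simp: proper_colouring_def)
  qed
  ultimately have "proper_colouring W E (card I * b) c"
    by (auto simp: proper_colouring_def)
  then show ?thesis
    by blast
qed

section \<open>Ranks, and the colouring that lowers the clique number\<close>

text \<open>The function \<open>r\<close> gives the round of removal. The first conjunct says why
  \<open>w\<close> survives every round \<open>n\<close> before its own: an overlapping pair still
  present then contains it. The second says why it is removed in its own round: no such pair
  remains.\<close>

lemma overlap_rank_exists:
  fixes \<mu> :: "'a \<Rightarrow> 'b set"
  assumes "finite W"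
  shows "\<exists>r :: 'a \<Rightarrow> nat.
    (\<forall>w\<in>W. \<forall>n<r w. \<exists>u\<in>W. \<exists>v\<in>W. n \<le> r u \<and> n \<le> r v \<and>
       overlap (\<mu> u) (\<mu> v) \<and> \<mu> w \<subseteq> \<mu> u \<and> \<mu> w \<subseteq> \<mu> v) \<and>
    (\<forall>w\<in>W. \<forall>u\<in>W. \<forall>v\<in>W. r w \<le> r u \<longrightarrow> r w \<le> r v \<longrightarrow>
       overlap (\<mu> u) (\<mu> v) \<longrightarrow> \<not> (\<mu> w \<subseteq> \<mu> u \<and> \<mu> w \<subseteq> \<mu> v))"
  using assms
proof (induction W rule: finite_psubset_induct)
  case (psubset W)
  show ?case
  proof (cases "W = {}")
    case True
    then show ?thesis
      by simp
  next
    case False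
    define P where "P = {w \<in> W. \<exists>u\<in>W. \<exists>v\<in>W.
      overlap (\<mu> u) (\<mu> v) \<and> \<mu> w \<subseteq> \<mu> u \<and> \<mu> w \<subseteq> \<mu> v}"
    \<comment> \<open>Two members containing an inclusion-maximal one both equal it, so they cannot
      overlap. Hence the first round removes something and the induction applies to
      \<open>P\<close>.\<close>
    obtain A where A: "A \<in> \<mu> ` W" "\<forall>B\<in>\<mu> ` W. A \<subseteq> B \<longrightarrow> A = B"
      using finite_has_maximal[of "\<mu> ` W"] psubset.hyps False by blast
    then obtain w where "w \<in> W" "\<mu> w = A"
      by blast
    then have "w \<notin> P"
      using A(2) unfolding P_def overlap_def by blast
    then have "P \<subset> W"
      using \<open>w \<in> W\<close> unfolding P_def by blast
    from psubset.IH[OF this] obtain r :: "'a \<Rightarrow> nat" where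
      r1: "\<And>w n. w \<in> P \<Longrightarrow> n < r w \<Longrightarrow> \<exists>u\<in>P. \<exists>v\<in>P. n \<le> r u \<and> n \<le> r v \<and>
       overlap (\<mu> u) (\<mu> v) \<and> \<mu> w \<subseteq> \<mu> u \<and> \<mu> w \<subseteq> \<mu> v" and
      r2: "\<And>w u v. w \<in> P \<Longrightarrow> u \<in> P \<Longrightarrow> v \<in> P \<Longrightarrow> r w \<le> r u \<Longrightarrow> r w \<le> r v \<Longrightarrow>
       overlap (\<mu> u) (\<mu> v) \<Longrightarrow> \<not> (\<mu> w \<subseteq> \<mu> u \<and> \<mu> w \<subseteq> \<mu> v)"
      by metis
    define s where "s w = (if w \<in> P then Suc (r w) else 0)" for w
    show ?thesis
    proof (intro exI[of _ s] conjI ballI allI impI)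
      fix w n assume w: "w \<in> W" "n < s w"
      then have "w \<in> P"
        by (auto simp: s_def split: if_splits)
      show "\<exists>u\<in>W. \<exists>v\<in>W. n \<le> s u \<and> n \<le> s v \<and>
        overlap (\<mu> u) (\<mu> v) \<and> \<mu> w \<subseteq> \<mu> u \<and> \<mu> w \<subseteq> \<mu> v"
      proof (cases n)
        case 0
        then show ?thesis
          using \<open>w \<in> P\<close> by (auto simp: P_def)
      next
        case (Suc k)
        then have "k < r w"
          using w \<open>w \<in> P\<close> by (simp add: s_def)
        then obtain u v where uv: "u \<in> P" "v \<in> P" "k \<le> r u" "k \<le> r v"
          "overlap (\<mu> u) (\<mu> v)" "\<mu> w \<subseteq> \<mu> u" "\<mu> w \<subseteq> \<mu> v"
          using r1[OF \<open>w \<in> P\<close>] by blast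
        then have "n \<le> s u" "n \<le> s v" "u \<in> W" "v \<in> W"
          using Suc \<open>P \<subset> W\<close> by (auto simp: s_def)
        then show ?thesis
          using uv by blast
      qed
    next
      fix w u v
      assume *: "w \<in> W" "u \<in> W" "v \<in> W" "s w \<le> s u" "s w \<le> s v" "overlap (\<mu> u) (\<mu> v)"
      show "\<not> (\<mu> w \<subseteq> \<mu> u \<and> \<mu> w \<subseteq> \<mu> v)"
      proof (cases "w \<in> P")
        case True
        \<comment> \<open>Vertices outside \<open>P\<close> have rank 0, while \<open>s w\<close> is
          positive here.\<close>
        then have "u \<in> P" "v \<in> P" "r w \<le> r u" "r w \<le> r v"
          using * by (auto simp: s_def split: if_splits)
        then show ?thesis
          using r2 True * by blast
      next
        case False
        then show ?thesis
          using * unfolding P_def by blast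
      qed
    qed
  qed
qed

text \<open>The colour of a vertex is the parity of its rank together with a proper colour within
  its rank class, giving \<open>2 * a\<close> values. A clique of size \<open>Suc m\<close> in one
  fibre would grow by one when its vertex of highest rank is exchanged for an overlapping pair above
  it.\<close>

lemma clique_reducing_colouring:
  fixes \<mu> :: "'a \<Rightarrow> 'b set"
  assumes "finite W" and model: "overlap_model W E \<mu>"
    and cliques: "\<And>K. K \<subseteq> W \<Longrightarrow> clique K E \<Longrightarrow> card K \<le> Suc m"
    and "1 \<le> m"
    and clean: "\<And>X. X \<subseteq> W \<Longrightarrow> clean_model X \<mu> \<Longrightarrow> \<exists>c. proper_colouring X E a c"
  shows "\<exists>f :: 'a \<Rightarrow> bool \<times> nat. f ` W \<subseteq> UNIV \<times> {..<a} \<and>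
    (\<forall>i K. K \<subseteq> {w \<in> W. f w = i} \<longrightarrow> clique K E \<longrightarrow> card K \<le> m)"
proof -
  have edge: "{u, v} \<in> E \<longleftrightarrow> overlap (\<mu> u) (\<mu> v)" if "u \<in> W" "v \<in> W" for u v
    using model that by (auto simp: overlap_model_def)
  obtain r :: "'a \<Rightarrow> nat" where
    r1: "\<And>w n. w \<in> W \<Longrightarrow> n < r w \<Longrightarrow> \<exists>u\<in>W. \<exists>v\<in>W. n \<le> r u \<and> n \<le> r v \<and>
      overlap (\<mu> u) (\<mu> v) \<and> \<mu> w \<subseteq> \<mu> u \<and> \<mu> w \<subseteq> \<mu> v" and
    r2: "\<And>w u v. w \<in> W \<Longrightarrow> u \<in> W \<Longrightarrow> v \<in> W \<Longrightarrow> r w \<le> r u \<Longrightarrow> r w \<le> r v \<Longrightarrow>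
      overlap (\<mu> u) (\<mu> v) \<Longrightarrow> \<not> (\<mu> w \<subseteq> \<mu> u \<and> \<mu> w \<subseteq> \<mu> v)"
    using overlap_rank_exists[OF assms(1), of \<mu>] by metis
  have not_sub: "\<not> \<mu> x \<subseteq> \<mu> y" if "x \<in> W" "y \<in> W" "r x < r y" for x y
    using r1[OF that(2,3)] r2[OF that(1)] by blast
  \<comment> \<open>Within one class all ranks agree, so the rank comparisons in \<open>r2\<close>
    hold trivially.\<close>
  have "clean_model {w \<in> W. r w = n} \<mu>" for n
    using r2 unfolding clean_model_def by (auto 0 4)
  then have "\<exists>c. proper_colouring {w \<in> W. r w = n} E a c" for n
    by (intro clean) auto
  then obtain col where col: "\<And>n. proper_colouring {w \<in> W. r w = n} E a (col n)"
    by metis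
  define f where "f w = (even (r w), col (r w) w)" for w
  have "f ` W \<subseteq> UNIV \<times> {..<a}"
    using col by (auto simp: f_def proper_colouring_def)
  moreover have "card K \<le> m" if K: "K \<subseteq> {w \<in> W. f w = i}" "clique K E" for i K
  proof (rule ccontr)
    assume "\<not> card K \<le> m"
    have KW: "K \<subseteq> W"
      using K(1) by blast
    have "finite K"
      using KW assms(1) finite_subset by blast
    have "K \<noteq> {}"
      using \<open>\<not> card K \<le> m\<close> by auto
    obtain w where w: "w \<in> K" "\<And>x. x \<in> K \<Longrightarrow> r x \<le> r w"
    proof -
      have "Max (r ` K) \<in> r ` K"
        using \<open>finite K\<close> \<open>K \<noteq> {}\<close> by simp
      then obtain w where "w \<in> K" "r w = Max (r ` K)"
        by auto
      then show thesis
        using that[of w] \<open>finite K\<close> by simp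
    qed
    \<comment> \<open>Adjacent vertices of equal rank differ in \<open>col\<close>, and consecutive
      ranks differ in parity. The gap of two is needed since \<open>u\<close> and \<open>v\<close>
      below are only known to have rank at least \<open>r w - 1\<close>.\<close>
    have gap: "r x + 2 \<le> r w" if x: "x \<in> K" "x \<noteq> w" for x
    proof -
      have "{x, w} \<in> E"
        using K(2) w(1) x by (auto simp: clique_def)
      have fx: "f x = f w"
        using K(1) x(1) w(1) by auto
      have "r x \<noteq> r w"
      proof
        assume "r x = r w"
        then have "col (r w) x \<noteq> col (r w) w"
          using col[of "r w"] x(1) w(1) KW \<open>{x, w} \<in> E\<close> by (auto simp: proper_colouring_def)
        then show False
          using fx \<open>r x = r w\<close> by (simp add: f_def)
      qed
      then have "r x < r w"
        using w(2)[OF x(1)] by simp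
      moreover have "even (r x) = even (r w)"
        using fx by (simp add: f_def)
      ultimately show ?thesis
        by presburger
    qed
    have "\<exists>x\<in>K. x \<noteq> w"
    proof (rule ccontr)
      assume "\<not> ?thesis"
      then have "K \<subseteq> {w}"
        by blast
      then have "card K \<le> 1"
        using card_mono[of "{w}" K] by simp
      then show False
        using \<open>\<not> card K \<le> m\<close> \<open>1 \<le> m\<close> by simp
    qed
    \<comment> \<open>A second clique vertex exists because \<open>1 \<le> m\<close>; by
      \<open>gap\<close> it makes \<open>r w\<close> positive, so the truncated subtraction is
      harmless.\<close>
    then have "r w - 1 < r w"
      using gap by fastforce
    then obtain u v where uv: "u \<in> W" "v \<in> W" "r w - 1 \<le> r u" "r w - 1 \<le> r v"
      "overlap (\<mu> u) (\<mu> v)" "\<mu> w \<subseteq> \<mu> u" "\<mu> w \<subseteq> \<mu> v"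
      using r1[of w "r w - 1"] w(1) KW by blast
    \<comment> \<open>Passing from \<open>\<mu> w\<close> to the larger \<open>\<mu> y\<close> keeps
      the intersection with \<open>\<mu> x\<close> nonempty and keeps \<open>\<mu> x\<close> from
      containing it; only the inclusion of \<open>\<mu> x\<close> in \<open>\<mu> y\<close> must be
      excluded by rank.\<close>
    have ov: "overlap (\<mu> x) (\<mu> y)"
      if "x \<in> K - {w}" "y \<in> W" "r w - 1 \<le> r y" "\<mu> w \<subseteq> \<mu> y" for x y
    proof -
      have "overlap (\<mu> x) (\<mu> w)"
        using K(2) that(1) w(1) KW edge[of x w] by (auto simp: clique_def)
      moreover have "\<not> \<mu> x \<subseteq> \<mu> y"
      proof (rule not_sub)
        show "r x < r y"
          using gap[of x] that by auto
      qed (use that KW in auto)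
      ultimately show ?thesis
        using that(4) unfolding overlap_def by blast
    qed
    have irrefl: "\<not> overlap A A" for A :: "'b set"
      by (simp add: overlap_def)
    \<comment> \<open>If \<open>u\<close> or \<open>v\<close> were in \<open>K - {w}\<close>, then
      \<open>ov\<close> would make it overlap itself.\<close>
    have new: "u \<notin> K - {w}" "v \<notin> K - {w}" "u \<noteq> v"
      using ov uv irrefl by blast+
    have edges: "{u, v} \<in> E" "\<And>x. x \<in> K - {w} \<Longrightarrow> {x, u} \<in> E \<and> {x, v} \<in> E"
      using edge ov uv KW by auto
    have "clique (insert u (insert v (K - {w}))) E"
      using K(2) edges by (auto simp: clique_def insert_commute)
    then have "card (insert u (insert v (K - {w}))) \<le> Suc m"
      using KW uv by (intro cliques) auto
    moreover have "card (insert u (insert v (K - {w}))) = Suc (card K)"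
      using new \<open>finite K\<close> w(1) card.remove[of K w] by simp
    ultimately show False
      using \<open>\<not> card K \<le> m\<close> by simp
  qed
  ultimately show ?thesis
    by blast
qed

section \<open>The product bound\<close>

text \<open>Induction on \<open>m\<close>: each of the at most \<open>2 * \<alpha> (Suc m)\<close>
  classes of the clique-reducing colouring has cliques of size at most \<open>m\<close>. The fixed
  \<open>k\<close> keeps the hypotheses on \<open>\<alpha>\<close> available while \<open>m\<close>
  and \<open>W\<close> vary.\<close>

lemma overlap_model_colouring:
  fixes \<mu> :: "'a \<Rightarrow> 'b set" and \<alpha> :: "nat \<Rightarrow> real"
  assumes "finite V" and model: "overlap_model V E \<mu>"
    and clean: "\<And>j X. 2 \<le> j \<Longrightarrow> j \<le> k \<Longrightarrow> X \<subseteq> V \<Longrightarrow> clean_model X \<mu> \<Longrightarrow>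
      (\<And>K. K \<subseteq> X \<Longrightarrow> clique K E \<Longrightarrow> card K \<le> j) \<Longrightarrow>
      \<exists>c. proper_colouring X E (nat \<lfloor>\<alpha> j\<rfloor>) c"
    and pos: "\<And>j. 2 \<le> j \<Longrightarrow> j \<le> k \<Longrightarrow> 0 \<le> \<alpha> j"
    and "m \<le> k" "W \<subseteq> V"
    and cliques: "\<And>K. K \<subseteq> W \<Longrightarrow> clique K E \<Longrightarrow> card K \<le> m"
  shows "\<exists>b c. real b \<le> (\<Prod>j=2..m. 2 * \<alpha> j) \<and> proper_colouring W E b c"
  using assms(5-)
proof (induction m arbitrary: W)
  case 0
  have "W = {}"
    using "0.prems"(3)[of "{w}" for w] by (auto simp: clique_def)
  then have "proper_colouring W E 0 (\<lambda>_. 0)"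
    by (simp add: proper_colouring_def)
  then show ?case
    by (intro exI[of _ 0] exI[of _ "\<lambda>_. 0"]) auto
next
  case (Suc m)
  have model_W: "overlap_model W E \<mu>"
    using model Suc.prems(2) unfolding overlap_model_def by (blast intro: inj_on_subset)
  have "finite W"
    using assms(1) Suc.prems(2) finite_subset by blast
  show ?case
  \<comment> \<open>With cliques of size at most 1 there are no edges: one colour suffices and the
    product is empty.\<close>
  proof (cases "m = 0")
    case True
    have False if uv: "u \<in> W" "v \<in> W" "{u, v} \<in> E" for u v
    proof -
      have "u \<noteq> v"
        using uv model_W by (auto simp: overlap_model_def overlap_def)
      moreover have "clique {u, v} E"
        using uv by (auto simp: clique_def insert_commute)
      ultimately show False
        using Suc.prems(3)[of "{u, v}"] uv True by simp
    qed
    then have "proper_colouring W E 1 (\<lambda>_. 0)"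
      by (auto simp: proper_colouring_def)
    then show ?thesis
      using True by (intro exI[of _ 1] exI[of _ "\<lambda>_. 0"]) auto
  next
    case False
    define a where "a = nat \<lfloor>\<alpha> (Suc m)\<rfloor>"
    define B where "B = (\<Prod>j=2..m. 2 * \<alpha> j)"
    have "\<exists>c. proper_colouring X E a c" if "X \<subseteq> W" "clean_model X \<mu>" for X
      unfolding a_def using False Suc.prems that by (intro clean) auto
    then obtain f :: "'a \<Rightarrow> bool \<times> nat" where
      f: "f ` W \<subseteq> UNIV \<times> {..<a}"
        "\<And>i K. K \<subseteq> {w \<in> W. f w = i} \<Longrightarrow> clique K E \<Longrightarrow> card K \<le> m"
      using clique_reducing_colouring[OF \<open>finite W\<close> model_W Suc.prems(3)] False
      by (metis One_nat_def Suc_leI neq0_conv)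
    \<comment> \<open>The number of colours from the induction hypothesis may depend on
      \<open>i\<close>; the floor of \<open>B\<close> serves all fibres at once.\<close>
    have "\<exists>c. proper_colouring {w \<in> W. f w = i} E (nat \<lfloor>B\<rfloor>) c" for i
    proof -
      have "\<exists>b c. real b \<le> B \<and> proper_colouring {w \<in> W. f w = i} E b c"
        unfolding B_def using Suc.prems f(2)[of _ i] by (intro Suc.IH) auto
      then show ?thesis
        by (metis le_nat_floor proper_colouring_mono)
    qed
    then obtain c where "proper_colouring W E (card (UNIV \<times> {..<a} :: (bool \<times> nat) set) * nat \<lfloor>B\<rfloor>) c"
      using proper_colouring_fibres[of "UNIV \<times> {..<a}" f W E "nat \<lfloor>B\<rfloor>"] f(1)
      by (metis finite_SigmaI finite_lessThan finite)
    then have "proper_colouring W E (2 * a * nat \<lfloor>B\<rfloor>) c"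
      by (simp add: card_cartesian_product)
    moreover have "real (2 * a * nat \<lfloor>B\<rfloor>) \<le> (\<Prod>j=2..Suc m. 2 * \<alpha> j)"
    proof -
      \<comment> \<open>For negative \<open>B\<close>, \<open>nat\<close> would round up to 0 and
        the next estimate would fail.\<close>
      have "0 \<le> B"
        unfolding B_def using pos Suc.prems(1) by (intro prod_nonneg) auto
      then have "real (nat \<lfloor>B\<rfloor>) \<le> B"
        by simp
      moreover have "real a \<le> \<alpha> (Suc m)" "0 \<le> \<alpha> (Suc m)"
        using pos[of "Suc m"] Suc.prems(1) False by (simp_all add: a_def)
      ultimately have "real (2 * a) * real (nat \<lfloor>B\<rfloor>) \<le> (2 * \<alpha> (Suc m)) * B"
        by (intro mult_mono) auto
      then show ?thesis
        using False by (simp add: B_def mult.commute)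
    qed
    ultimately show ?thesis
      by blast
  qed
qed

theorem theorem5p1:
  fixes V :: "'a set" and E :: "'a set set" and \<alpha> :: "nat \<Rightarrow> real"
  assumes "overlap_graph V E"
    and "\<And>j W. 2 \<le> j \<Longrightarrow> j \<le> clique_number V E \<Longrightarrow> W \<subseteq> V \<Longrightarrow>
           clean_overlap_graph W (induced_edges E W) \<Longrightarrow>
           clique_number W (induced_edges E W) \<le> j \<Longrightarrow>
           real (chromatic_number W (induced_edges E W)) \<le> \<alpha> j"
  shows "real (chromatic_number V E) \<le> (\<Prod>j=2..clique_number V E. 2 * \<alpha> j)"
proof -
  obtain \<mu> :: "'a \<Rightarrow> nat set" where model: "overlap_model V E \<mu>" and graph: "simple_graph V E"
    using assms(1) by (auto simp: overlap_graph_def)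
  have "finite V"
    using graph by (simp add: simple_graph_def)
  have bound: "real (chromatic_number X (induced_edges E X)) \<le> \<alpha> j"
    if "2 \<le> j" "j \<le> clique_number V E" "X \<subseteq> V" "clean_model X \<mu>"
      "\<And>K. K \<subseteq> X \<Longrightarrow> clique K E \<Longrightarrow> card K \<le> j" for j X
  proof (rule assms(2)[OF that(1-3)])
    have "overlap_model X E \<mu>"
      using model that(3) unfolding overlap_model_def by (blast intro: inj_on_subset)
    then have "overlap_model X (induced_edges E X) \<mu>"
      by (simp add: overlap_model_def induced_edges_def)
    then show "clean_overlap_graph X (induced_edges E X)"
      using simple_graph_induced[OF graph that(3)] that(4) by (auto simp: clean_overlap_graph_def)
    show "clique_number X (induced_edges E X) \<le> j"
      using that(5) finite_subset[OF that(3) \<open>finite V\<close>]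
      by (simp add: clique_number_le_iff clique_induced)
  qed
  have "\<exists>b c. real b \<le> (\<Prod>j=2..clique_number V E. 2 * \<alpha> j) \<and> proper_colouring V E b c"
  proof (rule overlap_model_colouring[OF \<open>finite V\<close> model _ _ order_refl order_refl])
    fix j X
    assume *: "2 \<le> j" "j \<le> clique_number V E" "X \<subseteq> V" "clean_model X \<mu>"
      "\<And>K. K \<subseteq> X \<Longrightarrow> clique K E \<Longrightarrow> card K \<le> j"
    \<comment> \<open>Chromatic numbers are integers, so the real bound may be rounded down.\<close>
    have "chromatic_number X (induced_edges E X) \<le> nat \<lfloor>\<alpha> j\<rfloor>"
      using bound[OF *] by (simp add: le_nat_floor)
    then show "\<exists>c. proper_colouring X E (nat \<lfloor>\<alpha> j\<rfloor>) c"
      using chromatic_number_le_iff[OF simple_graph_induced[OF graph *(3)]]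
      by (simp add: proper_colouring_induced)
  next
    fix j assume "2 \<le> j" "j \<le> clique_number V E"
    \<comment> \<open>The empty subgraph is clean, so its bound already forces
      \<open>\<alpha> j\<close> to be nonnegative.\<close>
    then have "real (chromatic_number {} (induced_edges E {})) \<le> \<alpha> j"
      by (rule bound) (auto simp: clean_model_def)
    then show "0 \<le> \<alpha> j"
      using of_nat_0_le_iff order_trans by blast
  next
    show "card K \<le> clique_number V E" if "K \<subseteq> V" "clique K E" for K
      using clique_number_le_iff[OF \<open>finite V\<close>, of E "clique_number V E"] that by simp
  qed
  then obtain b c where b: "real b \<le> (\<Prod>j=2..clique_number V E. 2 * \<alpha> j)"
    and c: "proper_colouring V E b c"
    by blast
  have "real (chromatic_number V E) \<le> real b"
    using chromatic_number_le_iff[OF graph] c by auto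
  then show ?thesis
    using b by linarith
qed

end
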